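(* Let $\Gamma$ be a finite, simple, undirected, loop-free, connected graph with vertex set $V$, $N = |V|$, and edge set $E$. Let $b: V\times V\to\mathbb{R}$ satisfy $b(x,y)=b(y,x)>0$ if $\{x,y\}\in E$ and $b(x,y)=0$ otherwise, and let $v:V\to\mathbb{R}$ be arbitrary. Let $\mathcal{H}$ be the Schrödinger operator acting on functions $f:V\to\mathbb{R}$ by $$\mathcal{H}f(x) = \sum_{y\sim x} b(x,y)\,[f(x)-f(y)] + v(x)f(x),$$ and let $\lambda_1\le\lambda_2\le\dots\le\lambda_N$ be its eigenvalues in non-decreasing order, repeated according to multiplicity. Let $1\le k\le N$, let $\underline{k}$ and $\overline{k}$ be respectively the smallest and the largest index $h\in\{1,\dots,N\}$ with $\lambda_h=\lambda_k$, and let $f_k:V\to\mathbb{R}$ be any (nonzero, real) eigenfunction of $\mathcal{H}$ with $\mathcal{H}f_k=\lambda_k f_k$. Then $f_k$ has at most $\underline{k}$ weak nodal domains and at most $\overline{k}$ strong nodal domains.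
   Context: Write $x\sim y$ if $\{x,y\}\in E$. A weak nodal domain of a function $f:V\to\mathbb{R}$ is a subset $D\subseteq V$ that is maximal (with respect to inclusion) subject to the two conditions: (i) $D$ is connected (as an induced subgraph of $\Gamma$); (ii) if $x,y\in D$ then $f(x)f(y)\ge 0$. A strong nodal domain of $f$ is a subset $D\subseteq V$ that is maximal (with respect to inclusion) subject to: (i) $D$ is connected (as an induced subgraph of $\Gamma$); (ii') if $x,y\in D$ then $f(x)f(y)>0$. Distinct weak nodal domains may overlap (in vertices where $f$ vanishes); the number of nodal domains is the number of distinct sets $D$ satisfying the definition. *)

theory Defs
  imports "HOL-Analysis.Analysis"
begin

text \<open>
  A graph is given by its edge set; its vertex set is the whole of a finite type \<open>'v\<close>, so that
  functions on the vertices form the Euclidean space \<open>real ^ 'v\<close>.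
\<close>

definition simple_graph :: "'v set set \<Rightarrow> bool" where
  "simple_graph E \<longleftrightarrow> (\<forall>e\<in>E. card e = 2)"

definition induced_connected :: "'v set set \<Rightarrow> 'v set \<Rightarrow> bool" where
  "induced_connected E D \<longleftrightarrow>
     D \<noteq> {} \<and> (\<forall>x\<in>D. \<forall>y\<in>D. (x, y) \<in> {(u, w). u \<in> D \<and> w \<in> D \<and> {u, w} \<in> E}\<^sup>*)"

definition schroedinger ::
  "'v set set \<Rightarrow> ('v \<Rightarrow> 'v \<Rightarrow> real) \<Rightarrow> ('v \<Rightarrow> real) \<Rightarrow> real ^ 'v \<Rightarrow> real ^ 'v::finite" where
  "schroedinger E b v f =
     (\<chi> x. (\<Sum>y | {x, y} \<in> E. b x y * (f $ x - f $ y)) + v x * f $ x)"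

definition eigenspace :: "(real ^ 'v \<Rightarrow> real ^ 'v::finite) \<Rightarrow> real \<Rightarrow> (real ^ 'v) set" where
  "eigenspace T \<mu> = {f. T f = \<mu> *\<^sub>R f}"

definition eigenvalues :: "(real ^ 'v \<Rightarrow> real ^ 'v::finite) \<Rightarrow> real set" where
  "eigenvalues T = {\<mu>. \<exists>f. f \<noteq> 0 \<and> T f = \<mu> *\<^sub>R f}"

text \<open>
  The multiplicity of an eigenvalue is the dimension of its eigenspace. For a self-adjoint
  operator it agrees with the algebraic multiplicity, and the list below has length \<open>CARD('v)\<close>.
\<close>

definition eigenvalue_list :: "(real ^ 'v \<Rightarrow> real ^ 'v::finite) \<Rightarrow> real list" where
  "eigenvalue_list T =
     concat (map (\<lambda>\<mu>. replicate (dim (eigenspace T \<mu>)) \<mu>) (sorted_list_of_set (eigenvalues T)))"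

text \<open>Indices of eigenvalues start at 1, those of lists at 0.\<close>

definition nth_eigenvalue :: "(real ^ 'v \<Rightarrow> real ^ 'v::finite) \<Rightarrow> nat \<Rightarrow> real" where
  "nth_eigenvalue T h = eigenvalue_list T ! (h - 1)"

definition maximal_set :: "('v set \<Rightarrow> bool) \<Rightarrow> 'v set \<Rightarrow> bool" where
  "maximal_set P D \<longleftrightarrow> P D \<and> (\<forall>D'. P D' \<and> D \<subseteq> D' \<longrightarrow> D' = D)"

definition weak_nodal_domain :: "'v set set \<Rightarrow> real ^ 'v \<Rightarrow> 'v::finite set \<Rightarrow> bool" where
  "weak_nodal_domain E f =
     maximal_set (\<lambda>D. induced_connected E D \<and> (\<forall>x\<in>D. \<forall>y\<in>D. f $ x * f $ y \<ge> 0))"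

definition strong_nodal_domain :: "'v set set \<Rightarrow> real ^ 'v \<Rightarrow> 'v::finite set \<Rightarrow> bool" where
  "strong_nodal_domain E f =
     maximal_set (\<lambda>D. induced_connected E D \<and> (\<forall>x\<in>D. \<forall>y\<in>D. f $ x * f $ y > 0))"

end

theory Submission
  imports Defs
begin

text \<open>
  Let \<open>H f = \<kappa> f\<close>. Each nodal domain \<open>D\<close> gives the restriction of \<open>f\<close> to \<open>D\<close>, and the
  restrictions for distinct domains are orthogonal and nonzero: \<open>m\<close> domains span an
  \<open>m\<close>-dimensional space of functions \<open>g\<close>, obtained from \<open>f\<close> by multiplying it on each domain \<open>D\<close>
  by a constant \<open>c D\<close>. On this space the quadratic form of \<open>H - \<kappa>\<close> is nonpositive, because
  \<open>2 \<langle>g, (H - \<kappa>) g\<rangle> = \<Sum> b(x,y) f(x) f(y) (c(x) - c(y))\<^sup>2\<close>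
  and an edge with \<open>f(x) f(y) > 0\<close> stays inside one domain
  (\<open>form_of_multiple_of_eigenfunction\<close>, \<open>form_of_rescale\<close>). Conversely, a function that is orthogonal
  to all eigenfunctions with eigenvalue less than \<open>\<kappa>\<close>, and at which the form is nonpositive,
  is itself an eigenfunction for \<open>\<kappa>\<close> (\<open>eigenvector_if_form_le\<close>).

  If the number of strong domains exceeded the number of eigenvalues \<open>\<le> \<kappa>\<close>, some \<open>g \<noteq> 0\<close> of this
  kind would be orthogonal to all the corresponding eigenfunctions. It would be an eigenfunction
  for \<open>\<kappa>\<close> and hence orthogonal to itself.

  If the number of weak domains exceeded the number of eigenvalues \<open>< \<kappa>\<close> by two or more, one could
  moreover choose \<open>g\<close> to vanish on one of the domains. Again \<open>g\<close> is an eigenfunction for \<open>\<kappa>\<close>.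
  A unique continuation argument now applies: vanishing spreads from a weak domain to each
  domain that an edge leads to. Over an edge on which \<open>f\<close> changes sign it does so because the
  sum above is zero; over a vertex where \<open>f\<close> is zero, because of the eigenvalue equation for \<open>g\<close>
  at this vertex. As the graph is connected, \<open>g = 0\<close>, a contradiction.

  Counting eigenvalues with multiplicity as list positions presupposes that the eigenspaces
  exhaust \<open>real ^ 'v\<close>. This spectral theorem, and the property of the form quoted above, both come
  from the fact that on a nonzero invariant subspace the form attains its minimum over the
  unit sphere at an eigenvector (\<open>least_eigenvector\<close>).
\<close>

section \<open>Symmetric operators\<close>

text \<open>
  Moving from \<open>g\<close> in the direction of the defect \<open>h = T g - \<mu> g\<close> changes the form
  \<open>\<langle>x, T x\<rangle> - \<mu> \<langle>x, x\<rangle>\<close> by \<open>2 t \<langle>h, h\<rangle> + t\<^sup>2 Q\<close>. For small negative \<open>t\<close> this would be negative unless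
  \<open>h = 0\<close>.
\<close>

lemma minimiser_of_form_is_eigenvector:
  fixes T :: "'a::real_inner \<Rightarrow> 'a"
  assumes "linear T"
    and sym: "\<And>x y. T x \<bullet> y = x \<bullet> T y"
    and "subspace S" "\<And>x. x \<in> S \<Longrightarrow> T x \<in> S"
    and ge: "\<And>x. x \<in> S \<Longrightarrow> \<mu> * (x \<bullet> x) \<le> x \<bullet> T x"
    and "g \<in> S" and eq: "g \<bullet> T g = \<mu> * (g \<bullet> g)"
  shows "T g = \<mu> *\<^sub>R g"
proof -
  interpret linear T by fact
  define h where "h = T g - \<mu> *\<^sub>R g"
  have hS: "h \<in> S"
    unfolding h_def using assms by (intro subspace_diff subspace_scale) auto
  define Q where "Q = h \<bullet> T h - \<mu> * (h \<bullet> h)"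
  have Q: "2 * t * (h \<bullet> h) + t\<^sup>2 * Q \<ge> 0" for t
  proof -
    have "g + t *\<^sub>R h \<in> S"
      using assms hS by (intro subspace_add subspace_scale) auto
    then have "\<mu> * ((g + t *\<^sub>R h) \<bullet> (g + t *\<^sub>R h)) \<le> (g + t *\<^sub>R h) \<bullet> T (g + t *\<^sub>R h)"
      by (rule ge)
    moreover have "(g + t *\<^sub>R h) \<bullet> T (g + t *\<^sub>R h)
        = g \<bullet> T g + 2 * t * (h \<bullet> T g) + t\<^sup>2 * (h \<bullet> T h)"
      using sym[of g h]
      by (simp add: add scale inner_add_left inner_add_right inner_commute power2_eq_square
          algebra_simps)
    moreover have "(g + t *\<^sub>R h) \<bullet> (g + t *\<^sub>R h) = g \<bullet> g + 2 * t * (h \<bullet> g) + t\<^sup>2 * (h \<bullet> h)"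
      by (simp add: inner_add_left inner_add_right inner_commute power2_eq_square algebra_simps)
    moreover have "h \<bullet> T g = \<mu> * (h \<bullet> g) + h \<bullet> h"
      by (simp add: h_def inner_diff_right)
    ultimately have "\<mu> * (g \<bullet> g + 2 * t * (h \<bullet> g) + t\<^sup>2 * (h \<bullet> h))
        \<le> \<mu> * (g \<bullet> g) + 2 * t * (\<mu> * (h \<bullet> g) + h \<bullet> h) + t\<^sup>2 * (h \<bullet> T h)"
      using eq by metis
    then show ?thesis by (simp add: Q_def algebra_simps)
  qed
  have "h \<bullet> h = 0"
  proof (rule ccontr)
    assume "h \<bullet> h \<noteq> 0"
    then have pos: "h \<bullet> h > 0"
      by simp
    \<comment> \<open>A value small enough for \<open>\<bar>t * Q\<bar> \<le> h \<bullet> h\<close>; the summand 1 covers \<open>Q = 0\<close>.\<close>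
    define t where "t = - (h \<bullet> h) / (\<bar>Q\<bar> + 1)"
    have "t < 0" using pos by (simp add: t_def divide_neg_pos)
    have "- (t * Q) \<le> \<bar>t\<bar> * \<bar>Q\<bar>" by (metis abs_ge_minus_self abs_mult)
    also have "\<dots> \<le> \<bar>t\<bar> * (\<bar>Q\<bar> + 1)" by (simp add: mult_left_mono)
    also have "\<dots> = h \<bullet> h"
      by (simp add: t_def abs_mult)
    finally have "- (t * Q) \<le> h \<bullet> h" .
    then have "2 * (h \<bullet> h) + t * Q > 0" using pos by linarith
    with \<open>t < 0\<close> have "t * (2 * (h \<bullet> h) + t * Q) < 0" by (rule mult_neg_pos)
    moreover have "t * (2 * (h \<bullet> h) + t * Q) = 2 * t * (h \<bullet> h) + t\<^sup>2 * Q"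
      by (simp add: algebra_simps power2_eq_square)
    ultimately show False using Q[of t] by linarith
  qed
  then show ?thesis by (simp add: h_def)
qed

locale symmetric_operator =
  fixes T :: "real ^ 'v \<Rightarrow> real ^ 'v::finite"
  assumes linear_T: "linear T"
    and symmetric: "T x \<bullet> y = x \<bullet> T y"
begin

lemma least_eigenvector:
  assumes "subspace S" and inv: "\<And>x. x \<in> S \<Longrightarrow> T x \<in> S" and "S \<noteq> {0}"
  obtains \<mu> g where "g \<in> S" "g \<noteq> 0" "T g = \<mu> *\<^sub>R g" "\<And>x. x \<in> S \<Longrightarrow> \<mu> * (x \<bullet> x) \<le> x \<bullet> T x"
proof -
  interpret linear T by (rule linear_T)
  have scaled: "x /\<^sub>R norm x \<in> S \<inter> sphere 0 1" if "x \<in> S" "x \<noteq> 0" for x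
    using that assms(1) by (auto intro: subspace_scale)
  have "compact (S \<inter> sphere 0 1)"
    using closed_subspace[OF assms(1)] by (simp add: closed_Int_compact)
  moreover have "S \<inter> sphere 0 1 \<noteq> {}"
    using scaled assms(3) subspace_0[OF assms(1)] by blast
  moreover have "continuous_on (S \<inter> sphere 0 1) (\<lambda>x. x \<bullet> T x)"
    by (intro continuous_intros linear_continuous_on linear_conv_bounded_linear[THEN iffD1] linear_T)
  ultimately obtain g where "g \<in> S \<inter> sphere 0 1"
    and min: "\<And>x. x \<in> S \<inter> sphere 0 1 \<Longrightarrow> g \<bullet> T g \<le> x \<bullet> T x"
    using continuous_attains_inf[of "S \<inter> sphere 0 1" "\<lambda>x. x \<bullet> T x"] by blast
  then have g: "g \<in> S" "norm g = 1" by auto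
  define \<mu> where "\<mu> = g \<bullet> T g"
  have ge: "\<mu> * (x \<bullet> x) \<le> x \<bullet> T x" if "x \<in> S" for x
  proof (cases "x = 0")
    case False
    have "\<mu> \<le> (x /\<^sub>R norm x) \<bullet> T (x /\<^sub>R norm x)"
      unfolding \<mu>_def by (rule min[OF scaled[OF that False]])
    also have "\<dots> = (x \<bullet> T x) / (x \<bullet> x)"
      by (simp add: scale dot_square_norm power2_eq_square divide_inverse)
    finally show ?thesis using False by (simp add: field_simps)
  qed (simp add: zero)
  have "T g = \<mu> *\<^sub>R g"
    using minimiser_of_form_is_eigenvector[OF linear_T symmetric assms(1) inv ge g(1)] g
    by (simp add: \<mu>_def dot_square_norm)
  moreover have "g \<noteq> 0" using g by auto
  ultimately show ?thesis using that g ge by blast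
qed

lemma eigenspaces_orthogonal:
  assumes "x \<in> eigenspace T \<mu>" "y \<in> eigenspace T \<nu>" "\<mu> \<noteq> \<nu>"
  shows "x \<bullet> y = 0"
proof -
  have "\<mu> * (x \<bullet> y) = \<nu> * (x \<bullet> y)"
    using symmetric[of x y] assms by (simp add: eigenspace_def)
  then show ?thesis using assms(3) by simp
qed

lemma finite_eigenvalues: "finite (eigenvalues T)"
proof -
  define e where "e \<mu> = (SOME f. f \<noteq> 0 \<and> T f = \<mu> *\<^sub>R f)" for \<mu>
  have e: "e \<mu> \<noteq> 0 \<and> T (e \<mu>) = \<mu> *\<^sub>R e \<mu>" if "\<mu> \<in> eigenvalues T" for \<mu>
    using that someI_ex[of "\<lambda>f. f \<noteq> 0 \<and> T f = \<mu> *\<^sub>R f"] by (simp add: e_def eigenvalues_def)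
  have orth: "e \<mu> \<bullet> e \<nu> = 0" if "\<mu> \<in> eigenvalues T" "\<nu> \<in> eigenvalues T" "\<mu> \<noteq> \<nu>" for \<mu> \<nu>
    using that e eigenspaces_orthogonal by (auto simp: eigenspace_def)
  then have "pairwise orthogonal (e ` eigenvalues T)"
    unfolding pairwise_def orthogonal_def by blast
  moreover have "inj_on e (eigenvalues T)"
    by (rule inj_onI) (metis e inner_eq_zero_iff orth)
  ultimately show ?thesis
    using pairwise_orthogonal_imp_finite finite_image_iff by blast
qed

lemma dim_Union_eigenspaces:
  assumes "finite A"
  shows "dim (\<Union>\<mu>\<in>A. eigenspace T \<mu>) = (\<Sum>\<mu>\<in>A. dim (eigenspace T \<mu>))"
  using assms
proof (induction rule: finite_induct)
  case (insert \<mu> A)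
  have "dim (eigenspace T \<mu> \<union> (\<Union>\<nu>\<in>A. eigenspace T \<nu>))
      = dim (eigenspace T \<mu>) + dim (\<Union>\<nu>\<in>A. eigenspace T \<nu>)"
    using insert.hyps by (intro dim_orthogonal_sum) (auto intro: eigenspaces_orthogonal)
  then show ?case using insert by simp
qed simp

lemma orthogonal_to_eigenspaces_invariant:
  assumes "\<And>\<mu> a. \<mu> \<in> A \<Longrightarrow> a \<in> eigenspace T \<mu> \<Longrightarrow> a \<bullet> x = 0" "\<mu> \<in> A" "a \<in> eigenspace T \<mu>"
  shows "a \<bullet> T x = 0"
  using symmetric[of a x] assms(2,3) assms(1)[OF assms(2,3)] by (simp add: eigenspace_def)

text \<open>
  The complement of the lower eigenspaces is invariant, so the form on it is bounded below by the
  least eigenvalue occurring there, which is at least \<open>\<kappa>\<close>. The hypothesis \<open>le\<close> thus makes \<open>x\<close> a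
  point where the bound \<open>\<kappa>\<close> is attained.
\<close>

lemma eigenvector_if_form_le:
  assumes "\<And>\<mu> a. \<mu> < \<kappa> \<Longrightarrow> a \<in> eigenspace T \<mu> \<Longrightarrow> a \<bullet> x = 0"
    and le: "x \<bullet> T x \<le> \<kappa> * (x \<bullet> x)"
  shows "T x = \<kappa> *\<^sub>R x"
proof -
  define S where "S = {x. \<forall>\<mu> a. \<mu> < \<kappa> \<longrightarrow> a \<in> eigenspace T \<mu> \<longrightarrow> a \<bullet> x = 0}"
  have S: "subspace S"
    by (auto simp: S_def subspace_def inner_add_right)
  have inv: "T x \<in> S" if "x \<in> S" for x
    using that orthogonal_to_eigenspaces_invariant[of "{..<\<kappa>}" x] by (auto simp: S_def)
  have ge: "\<kappa> * (x \<bullet> x) \<le> x \<bullet> T x" if x: "x \<in> S" for x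
  proof (cases "S = {0}")
    case True
    then show ?thesis using x linear_0[OF linear_T] by simp
  next
    case False
    obtain \<mu> g where g: "g \<in> S" "g \<noteq> 0" "T g = \<mu> *\<^sub>R g"
      and \<mu>: "\<And>x. x \<in> S \<Longrightarrow> \<mu> * (x \<bullet> x) \<le> x \<bullet> T x"
      using least_eigenvector[OF S inv False] by blast
    have "\<kappa> \<le> \<mu>"
      using g by (force simp: S_def eigenspace_def not_less[symmetric])
    then have "\<kappa> * (x \<bullet> x) \<le> \<mu> * (x \<bullet> x)" by (simp add: mult_right_mono)
    with \<mu>[OF x] show ?thesis by simp
  qed
  have x: "x \<in> S" using assms by (simp add: S_def)
  show ?thesis
    by (rule minimiser_of_form_is_eigenvector[OF linear_T symmetric S inv ge x])
      (use ge[OF x] le in auto)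
qed

text \<open>
  The spectral theorem in the form of a count: the orthogonal complement of all eigenspaces is
  invariant, but has no eigenvector, so it is trivial.
\<close>

lemma sum_dim_eigenspaces: "(\<Sum>\<mu>\<in>eigenvalues T. dim (eigenspace T \<mu>)) = CARD('v)"
proof -
  let ?W = "\<Union>\<mu>\<in>eigenvalues T. eigenspace T \<mu>"
  define S where "S = {x. \<forall>a\<in>?W. orthogonal a x}"
  have S: "subspace S"
    unfolding S_def by (rule subspace_orthogonal_to_vectors)
  have inv: "T x \<in> S" if "x \<in> S" for x
  proof -
    have "a \<bullet> x = 0" if "\<mu> \<in> eigenvalues T" "a \<in> eigenspace T \<mu>" for \<mu> a
      using \<open>x \<in> S\<close> that unfolding S_def orthogonal_def by blast
    then show ?thesis
      using orthogonal_to_eigenspaces_invariant[of "eigenvalues T" x]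
      unfolding S_def orthogonal_def by blast
  qed
  have "S = {0}"
  proof (rule ccontr)
    assume nz: "S \<noteq> {0}"
    obtain \<mu> g where g: "g \<in> S" "g \<noteq> 0" "T g = \<mu> *\<^sub>R g"
      by (rule least_eigenvector[OF S inv nz]) (assumption, rule that)
    then have "\<mu> \<in> eigenvalues T" "g \<in> eigenspace T \<mu>"
      unfolding eigenvalues_def eigenspace_def by blast+
    then have "orthogonal g g" using g(1) unfolding S_def by blast
    with g(2) show False by (simp add: orthogonal_self)
  qed
  moreover have "{y \<in> UNIV. \<forall>x\<in>span ?W. orthogonal x y} \<subseteq> S"
  proof
    fix y assume "y \<in> {y \<in> UNIV. \<forall>x\<in>span ?W. orthogonal x y}"
    then have "orthogonal a y" if "a \<in> ?W" for a
      using span_base[OF that] by simp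
    then show "y \<in> S" unfolding S_def by blast
  qed
  ultimately have "dim {y \<in> UNIV. \<forall>x\<in>span ?W. orthogonal x y} = 0"
    by simp
  moreover have "dim {y \<in> UNIV. \<forall>x\<in>span ?W. orthogonal x y} + dim (span ?W)
      = dim (UNIV :: (real ^ 'v) set)"
    by (rule dim_subspace_orthogonal_to_vectors) auto
  ultimately have "dim (span ?W) = dim (UNIV :: (real ^ 'v) set)"
    by linarith
  then have "dim ?W = CARD('v)" by simp
  then show ?thesis by (simp add: dim_Union_eigenspaces finite_eigenvalues)
qed

end

section \<open>Positions in the list of eigenvalues\<close>

lemma sorted_concat_replicate:
  "sorted xs \<Longrightarrow> sorted (concat (map (\<lambda>x. replicate (n x) x) xs))"
  by (induction xs) (auto simp: sorted_append)

lemma length_filter_concat_replicate: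
  "length (filter P (concat (map (\<lambda>x. replicate (n x) x) xs))) = (\<Sum>x\<leftarrow>xs. if P x then n x else 0)"
  by (induction xs) auto

context symmetric_operator
begin

lemma sorted_eigenvalue_list: "sorted (eigenvalue_list T)"
  by (simp add: eigenvalue_list_def sorted_concat_replicate)

lemma card_eigenvalue_indices:
  "card {i. i < length (eigenvalue_list T) \<and> P (eigenvalue_list T ! i)}
    = dim (\<Union>\<mu>\<in>{\<mu> \<in> eigenvalues T. P \<mu>}. eigenspace T \<mu>)"
proof -
  have "card {i. i < length (eigenvalue_list T) \<and> P (eigenvalue_list T ! i)}
      = (\<Sum>\<mu>\<in>eigenvalues T. if P \<mu> then dim (eigenspace T \<mu>) else 0)"
    unfolding length_filter_conv_card[symmetric] eigenvalue_list_def length_filter_concat_replicate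
    using finite_eigenvalues by (simp add: sum_list_distinct_conv_sum_set)
  also have "\<dots> = (\<Sum>\<mu>\<in>{\<mu> \<in> eigenvalues T. P \<mu>}. dim (eigenspace T \<mu>))"
    using finite_eigenvalues by (simp add: sum.inter_filter)
  finally show ?thesis using finite_eigenvalues by (simp add: dim_Union_eigenspaces)
qed

lemma length_eigenvalue_list: "length (eigenvalue_list T) = CARD('v)"
  using card_eigenvalue_indices[of "\<lambda>_. True"]
  by (simp add: dim_Union_eigenspaces finite_eigenvalues sum_dim_eigenspaces)

text \<open>
  The dimension of the span of the eigenspaces below \<open>\<kappa>\<close> counts the positions of smaller entries,
  and in a sorted list these all precede the position of \<open>\<kappa>\<close>.
\<close>

lemma first_eigenvalue_index_gt:
  assumes "h \<in> {1..CARD('v)}" "nth_eigenvalue T h = \<kappa>"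
  shows "dim (\<Union>\<mu>\<in>{\<mu> \<in> eigenvalues T. \<mu> < \<kappa>}. eigenspace T \<mu>) < h"
proof -
  let ?L = "eigenvalue_list T"
  have h: "h - 1 < length ?L" using assms(1) by (auto simp: length_eigenvalue_list)
  have "i < h - 1" if "i < length ?L" "?L ! i < \<kappa>" for i
    using that assms(2) sorted_nth_mono[OF sorted_eigenvalue_list, of "h - 1" i]
    unfolding nth_eigenvalue_def by linarith
  then have "card {i. i < length ?L \<and> ?L ! i < \<kappa>} \<le> card {..<h - 1}"
    by (intro card_mono) auto
  then show ?thesis
    using assms(1) by (auto simp: card_eigenvalue_indices[of "\<lambda>\<mu>. \<mu> < \<kappa>"])
qed

lemma last_eigenvalue_index_ge:
  assumes "k \<in> {1..CARD('v)}" "nth_eigenvalue T k = \<kappa>"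
    and last: "\<And>h. h \<in> {1..CARD('v)} \<Longrightarrow> nth_eigenvalue T h = \<kappa> \<Longrightarrow> h \<le> m"
  shows "dim (\<Union>\<mu>\<in>{\<mu> \<in> eigenvalues T. \<mu> \<le> \<kappa>}. eigenspace T \<mu>) \<le> m"
proof -
  let ?L = "eigenvalue_list T"
  have "i < m" if i: "i < length ?L" "?L ! i \<le> \<kappa>" for i
  proof (cases "i < k - 1")
    case True
    then show ?thesis using last[OF assms(1,2)] by simp
  next
    case False
    then have "\<kappa> \<le> ?L ! i"
      using sorted_nth_mono[OF sorted_eigenvalue_list, of "k - 1" i] i assms(2)
      by (simp add: nth_eigenvalue_def)
    then have "nth_eigenvalue T (Suc i) = \<kappa>" using i by (simp add: nth_eigenvalue_def)
    then show ?thesis using last[of "Suc i"] i by (simp add: length_eigenvalue_list)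
  qed
  then have "card {i. i < length ?L \<and> ?L ! i \<le> \<kappa>} \<le> card {..<m}"
    by (intro card_mono) auto
  then show ?thesis by (simp add: card_eigenvalue_indices[of "\<lambda>\<mu>. \<mu> \<le> \<kappa>"])
qed

end

section \<open>Maximal connected sets of one sign\<close>

lemma induced_connected_Un:
  assumes "induced_connected E D" "induced_connected E D'" "x \<in> D" "x \<in> D'"
  shows "induced_connected E (D \<union> D')"
proof -
  let ?r = "\<lambda>D. {(u, w). u \<in> D \<and> w \<in> D \<and> {u, w} \<in> E}"
  have "(?r D)\<^sup>* \<subseteq> (?r (D \<union> D'))\<^sup>*"
    by (rule rtrancl_mono) blast
  moreover have "(?r D')\<^sup>* \<subseteq> (?r (D \<union> D'))\<^sup>*"
    by (rule rtrancl_mono) blast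
  ultimately have "(z, x) \<in> (?r (D \<union> D'))\<^sup>* \<and> (x, z) \<in> (?r (D \<union> D'))\<^sup>*" if "z \<in> D \<union> D'" for z
    using that assms unfolding induced_connected_def by blast
  then show ?thesis
    using assms unfolding induced_connected_def by (blast intro: rtrancl_trans)
qed

lemma induced_connected_singleton: "induced_connected E {x}"
  by (simp add: induced_connected_def)

lemma induced_connected_edge:
  assumes "{x, y} \<in> E"
  shows "induced_connected E {x, y}"
  using assms by (auto simp: induced_connected_def insert_commute intro!: r_into_rtrancl)

lemma induced_connected_insert:
  assumes "induced_connected E D" "x \<in> D" "{x, y} \<in> E"
  shows "induced_connected E (insert y D)"
  using induced_connected_Un[OF assms(1) induced_connected_edge[OF assms(3)] assms(2)] assms(2)
  by (simp add: insert_absorb)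

lemma induced_connected_closed_eq_UNIV:
  assumes "induced_connected E UNIV" "x \<in> D"
    and closed: "\<And>y z. y \<in> D \<Longrightarrow> {y, z} \<in> E \<Longrightarrow> z \<in> D"
  shows "D = UNIV"
proof -
  have "y \<in> D" if "(x, y) \<in> {(u, w). u \<in> UNIV \<and> w \<in> UNIV \<and> {u, w} \<in> E}\<^sup>*" for y
    using that by induction (use assms(2) closed in auto)
  then show ?thesis using assms(1) unfolding induced_connected_def by blast
qed

text \<open>
  The two kinds of nodal domain are treated together, with \<open>R t\<close> standing for \<open>t \<ge> 0\<close> or \<open>t > 0\<close>.
  Lemmas about a general \<open>R\<close> assume that it lies between these two.
\<close>

definition one_signed :: "'v set set \<Rightarrow> (real \<Rightarrow> bool) \<Rightarrow> real ^ 'v::finite \<Rightarrow> 'v set \<Rightarrow> bool" where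
  "one_signed E R f D \<longleftrightarrow> induced_connected E D \<and> (\<forall>x\<in>D. \<forall>y\<in>D. R (f $ x * f $ y))"

lemma weak_nodal_domain_eq: "weak_nodal_domain E f = maximal_set (one_signed E (\<lambda>t. t \<ge> 0) f)"
  by (simp add: weak_nodal_domain_def one_signed_def[abs_def])

lemma strong_nodal_domain_eq: "strong_nodal_domain E f = maximal_set (one_signed E (\<lambda>t. t > 0) f)"
  by (simp add: strong_nodal_domain_def one_signed_def[abs_def])

lemma maximal_set_superset:
  fixes D :: "'v::finite set"
  assumes "P D"
  obtains M where "maximal_set P M" "D \<subseteq> M"
  using finite_has_maximal2[of "{D. P D}" D] assms unfolding maximal_set_def by auto

lemma maximal_setD:
  assumes "maximal_set P D"
  shows "P D" and "P D' \<Longrightarrow> D \<subseteq> D' \<Longrightarrow> D' = D"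
  using assms by (auto simp: maximal_set_def)

lemma sign_trans:
  fixes a b c :: real
  assumes R: "\<And>t. t > 0 \<Longrightarrow> R t" "\<And>t. R t \<Longrightarrow> t \<ge> 0"
    and "R (a * c)" "R (b * c)" "c \<noteq> 0"
  shows "R (a * b)"
proof (cases "a = 0 \<or> b = 0")
  case True
  then show ?thesis using assms(3,4) by auto
next
  case False
  then have "a * c > 0" "b * c > 0"
    using R(2)[OF assms(3)] R(2)[OF assms(4)] assms(5) by (auto simp: less_le)
  then have "a * b > 0" by (auto simp: zero_less_mult_iff)
  then show ?thesis by (rule R(1))
qed

text \<open>
  What the weak and the strong nodal domains of \<open>f\<close> have in common. Weak domains may overlap,
  but only in zeros of \<open>f\<close>; hence uniqueness is required at the other vertices only, and the
  restrictions of \<open>f\<close> to the members still have disjoint supports.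
\<close>

definition nodal_family :: "'v set set \<Rightarrow> real ^ 'v::finite \<Rightarrow> 'v set set \<Rightarrow> bool" where
  "nodal_family E f F \<longleftrightarrow>
     (\<forall>D\<in>F. \<exists>x\<in>D. f $ x \<noteq> 0) \<and>
     (\<forall>x. f $ x \<noteq> 0 \<longrightarrow> (\<exists>!D. D \<in> F \<and> x \<in> D)) \<and>
     (\<forall>x y D. {x, y} \<in> E \<longrightarrow> f $ x * f $ y > 0 \<longrightarrow> D \<in> F \<longrightarrow> x \<in> D \<longrightarrow> y \<in> D)"

lemma one_signed_insert:
  assumes "one_signed E R f D" "x \<in> D" "{x, y} \<in> E"
    and "\<And>z. z \<in> D \<Longrightarrow> R (f $ z * f $ y)" "R (f $ y * f $ y)"
  shows "one_signed E R f (insert y D)"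
  using assms induced_connected_insert[of E D x y] unfolding one_signed_def
  by (auto simp: mult.commute)

lemma maximal_set_one_signed_insert:
  assumes "maximal_set (one_signed E R f) D" "x \<in> D" "{x, y} \<in> E"
    and "\<And>z. z \<in> D \<Longrightarrow> R (f $ z * f $ y)" "R (f $ y * f $ y)"
  shows "y \<in> D"
  using one_signed_insert[of E R f D x y] assms maximal_setD[of _ D] by blast

text \<open>
  Two one-signed connected sets that share a vertex with \<open>f \<noteq> 0\<close> have the same sign, so their
  union is one-signed and connected, and maximality makes them equal.
\<close>

lemma nodal_family_maximal_sets:
  assumes R: "\<And>t. t > 0 \<Longrightarrow> R t" "\<And>t. R t \<Longrightarrow> t \<ge> 0"
    and nonzero: "\<And>D. maximal_set (one_signed E R f) D \<Longrightarrow> \<exists>x\<in>D. f $ x \<noteq> 0"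
  shows "nodal_family E f {D. maximal_set (one_signed E R f) D}"
proof -
  note trans = sign_trans[of R, OF R]
  have "\<exists>!D. maximal_set (one_signed E R f) D \<and> x \<in> D" if x: "f $ x \<noteq> 0" for x
  proof -
    have "f $ x * f $ x > 0" using x by (auto simp: zero_less_mult_iff)
    then have "one_signed E R f {x}"
      using R(1) by (simp add: one_signed_def induced_connected_singleton)
    then have "\<exists>D. maximal_set (one_signed E R f) D \<and> x \<in> D"
      by (metis maximal_set_superset insert_subset)
    moreover have "D = D'"
      if D: "maximal_set (one_signed E R f) D" "x \<in> D"
        and D': "maximal_set (one_signed E R f) D'" "x \<in> D'" for D D'
    proof -
      note s = maximal_setD(1)[OF D(1)] maximal_setD(1)[OF D'(1)]
      have "R (f $ z * f $ x)" if "z \<in> D \<union> D'" for z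
        using that s D(2) D'(2) by (auto simp: one_signed_def)
      then have "one_signed E R f (D \<union> D')"
        using s induced_connected_Un[of E D D' x] D(2) D'(2) trans x unfolding one_signed_def by blast
      then show ?thesis
        using maximal_setD(2)[OF D(1)] maximal_setD(2)[OF D'(1)] by blast
    qed
    ultimately show ?thesis by blast
  qed
  moreover have "y \<in> D"
    if e: "{x, y} \<in> E" and xy: "f $ x * f $ y > 0" and D: "maximal_set (one_signed E R f) D" "x \<in> D"
    for x y D
  proof (rule maximal_set_one_signed_insert[OF D e])
    show "R (f $ z * f $ y)" if "z \<in> D" for z
    proof (rule trans)
      show "R (f $ z * f $ x)"
        using maximal_setD(1)[OF D(1)] that D(2) by (auto simp: one_signed_def)
      show "R (f $ y * f $ x)" using R(1) xy by (simp add: mult.commute)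
      show "f $ x \<noteq> 0" using xy by auto
    qed
    show "R (f $ y * f $ y)" using R(1) xy by (auto simp: zero_less_mult_iff)
  qed
  ultimately show ?thesis using nonzero by (auto simp: nodal_family_def)
qed

lemma nodal_family_strong: "nodal_family E f {D. strong_nodal_domain E f D}"
  unfolding strong_nodal_domain_eq
proof (rule nodal_family_maximal_sets)
  fix D assume "maximal_set (one_signed E (\<lambda>t. t > 0) f) D"
  then show "\<exists>x\<in>D. f $ x \<noteq> 0"
    unfolding maximal_set_def one_signed_def induced_connected_def
    by (metis ex_in_conv mult_zero_left less_irrefl)
qed auto

text \<open>
  A weak domain on which \<open>f\<close> vanishes could be enlarged by any neighbour, so it would be the whole
  graph.
\<close>

lemma nodal_family_weak:
  assumes "induced_connected E UNIV" "f \<noteq> 0"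
  shows "nodal_family E f {D. weak_nodal_domain E f D}"
  unfolding weak_nodal_domain_eq
proof (rule nodal_family_maximal_sets)
  fix D assume D: "maximal_set (one_signed E (\<lambda>t. t \<ge> 0) f) D"
  show "\<exists>x\<in>D. f $ x \<noteq> 0"
  proof (rule ccontr)
    assume zero: "\<not> ?thesis"
    have "D \<noteq> {}" using D by (auto simp: maximal_set_def one_signed_def induced_connected_def)
    moreover have "z \<in> D" if "y \<in> D" "{y, z} \<in> E" for y z
      using zero by (intro maximal_set_one_signed_insert[OF D that]) auto
    ultimately have "D = UNIV" using induced_connected_closed_eq_UNIV[OF assms(1)] by blast
    with zero assms(2) show False by (auto simp: vec_eq_iff)
  qed
qed auto

lemma weak_nodal_domain_neighbour:
  assumes "weak_nodal_domain E f D" "x \<in> D" "{x, y} \<in> E" "\<And>z. z \<in> D \<Longrightarrow> f $ z * f $ y \<ge> 0"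
  shows "y \<in> D"
  using maximal_set_one_signed_insert[of E "\<lambda>t. t \<ge> 0" f D x y] assms
  by (simp add: weak_nodal_domain_eq)

section \<open>Functions rescaled on each domain\<close>

definition restrict_to :: "real ^ 'v::finite \<Rightarrow> 'v set \<Rightarrow> real ^ 'v" where
  "restrict_to f D = (\<chi> x. if x \<in> D then f $ x else 0)"

definition rescale :: "real ^ 'v::finite \<Rightarrow> 'v set set \<Rightarrow> ('v set \<Rightarrow> real) \<Rightarrow> real ^ 'v" where
  "rescale f F c = (\<Sum>D\<in>F. c D *\<^sub>R restrict_to f D)"

lemma rescale_nth_zero: "f $ x = 0 \<Longrightarrow> rescale f F c $ x = 0"
  by (auto simp: rescale_def restrict_to_def intro!: sum.neutral)

lemma rescale_nth:
  assumes "nodal_family E f F" "D \<in> F" "x \<in> D"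
  shows "rescale f F c $ x = c D * f $ x"
proof (cases "f $ x = 0")
  case False
  then have "x \<in> D' \<longleftrightarrow> D' = D" if "D' \<in> F" for D'
    using assms that unfolding nodal_family_def by metis
  then have "(\<Sum>D'\<in>F. c D' * (if x \<in> D' then f $ x else 0))
      = (\<Sum>D'\<in>F. if D' = D then c D * f $ x else 0)"
    by (intro sum.cong) auto
  then show ?thesis using assms(2) by (simp add: rescale_def restrict_to_def)
qed (simp add: rescale_nth_zero)

text \<open>
  A dimension count: the restrictions to the members of \<open>G\<close> are orthogonal and nonzero, so their
  span has dimension \<open>card G\<close> and meets the orthogonal complement of \<open>A\<close>.
\<close>

lemma exists_rescale_orthogonal:
  fixes f :: "real ^ 'v::finite"
  assumes F: "nodal_family E f F" and "G \<subseteq> F" and "dim A < card G"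
  obtains c where "\<And>D. D \<notin> G \<Longrightarrow> c D = 0" "rescale f F c \<noteq> 0"
    "\<And>a. a \<in> A \<Longrightarrow> a \<bullet> rescale f F c = 0"
proof -
  let ?w = "restrict_to f"
  let ?C = "{y \<in> UNIV. \<forall>x\<in>span A. orthogonal x y}"
  have nonzero: "?w D \<noteq> 0" if "D \<in> G" for D
  proof -
    obtain x where "x \<in> D" "f $ x \<noteq> 0"
      using \<open>D \<in> G\<close> assms(1,2) unfolding nodal_family_def by blast
    then have "?w D $ x \<noteq> 0" by (simp add: restrict_to_def)
    then show ?thesis by auto
  qed
  have "?w D $ x * ?w D' $ x = 0" if "D \<in> G" "D' \<in> G" "D \<noteq> D'" for D D' x
  proof (rule ccontr)
    assume "\<not> ?thesis"
    then have "f $ x \<noteq> 0" "x \<in> D" "x \<in> D'"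
      by (auto simp: restrict_to_def split: if_splits)
    then show False
      using that assms(1,2) unfolding nodal_family_def by blast
  qed
  then have orth: "?w D \<bullet> ?w D' = 0" if "D \<in> G" "D' \<in> G" "D \<noteq> D'" for D D'
    using that unfolding inner_vec_def inner_real_def by (simp add: sum.neutral)
  have inj: "inj_on ?w G"
    by (rule inj_onI) (metis orth nonzero inner_eq_zero_iff)
  have "independent (?w ` G)"
    using orth nonzero
    by (intro pairwise_orthogonal_independent) (auto simp: pairwise_def orthogonal_def)
  then have "dim (span (?w ` G)) = card G"
    by (simp add: dim_eq_card_independent card_image inj)
  moreover have "dim ?C + dim (span A) = dim (UNIV :: (real ^ 'v) set)"
    by (rule dim_subspace_orthogonal_to_vectors) auto
  moreover have "subspace ?C"
    by (auto simp: subspace_def orthogonal_def inner_add_right)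
  then have "dim {x + y |x y. x \<in> span (?w ` G) \<and> y \<in> ?C} + dim (span (?w ` G) \<inter> ?C)
      = dim (span (?w ` G)) + dim ?C"
    by (intro dim_sums_Int) auto
  moreover have "dim {x + y |x y. x \<in> span (?w ` G) \<and> y \<in> ?C} \<le> dim (UNIV :: (real ^ 'v) set)"
    by (rule dim_subset) auto
  ultimately have "dim (span (?w ` G) \<inter> ?C) > 0"
    using assms(3) by simp
  then have "\<not> span (?w ` G) \<inter> ?C \<subseteq> {0}"
    by (simp only: dim_eq_0[symmetric]) 
  then obtain g where g: "g \<in> span (?w ` G)" "g \<in> ?C" "g \<noteq> 0" by blast
  obtain u where "g = (\<Sum>w\<in>?w ` G. u w *\<^sub>R w)"
    using g(1) by (auto simp: span_finite)
  then have "g = (\<Sum>D\<in>G. u (?w D) *\<^sub>R ?w D)"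
    by (simp add: sum.reindex[OF inj])
  also have "\<dots> = rescale f F (\<lambda>D. if D \<in> G then u (?w D) else 0)"
    unfolding rescale_def using assms(2) by (intro sum.mono_neutral_cong_left) auto
  finally have "g = rescale f F (\<lambda>D. if D \<in> G then u (?w D) else 0)" .
  with g show ?thesis
    by (intro that[of "\<lambda>D. if D \<in> G then u (?w D) else 0"]) (auto simp: orthogonal_def intro: span_base)
qed

section \<open>The quadratic form of the Schroedinger operator\<close>

locale weighted_graph =
  fixes E :: "'v::finite set set" and b :: "'v \<Rightarrow> 'v \<Rightarrow> real" and v :: "'v \<Rightarrow> real"
  assumes weight_commute: "b x y = b y x"
    and weight_pos: "{x, y} \<in> E \<Longrightarrow> b x y > 0"
    and weight_zero: "{x, y} \<notin> E \<Longrightarrow> b x y = 0"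
begin

abbreviation "H \<equiv> schroedinger E b v"

lemma schroedinger_nth: "H g $ x = (\<Sum>y\<in>UNIV. b x y * (g $ x - g $ y)) + v x * g $ x"
proof -
  have "(\<Sum>y | {x, y} \<in> E. b x y * (g $ x - g $ y)) = (\<Sum>y\<in>UNIV. b x y * (g $ x - g $ y))"
    by (rule sum.mono_neutral_left) (auto simp: weight_zero)
  then show ?thesis by (simp add: schroedinger_def)
qed

lemma sum_flip: "(\<Sum>x\<in>UNIV. \<Sum>y\<in>UNIV. b x y * p x y) = (\<Sum>x\<in>UNIV. \<Sum>y\<in>UNIV. b x y * p y x)"
  by (subst sum.swap) (simp add: weight_commute)

sublocale symmetric_operator H
proof (rule symmetric_operator.intro)
  show "linear H"
    by (rule linearI) (simp_all add: vec_eq_iff schroedinger_nth algebra_simps sum.distrib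
        sum_subtractf sum_distrib_left)
  fix g h :: "real ^ 'v"
  have "H g \<bullet> h - g \<bullet> H h = (\<Sum>x\<in>UNIV. H g $ x * h $ x - g $ x * H h $ x)"
    by (simp add: inner_vec_def sum_subtractf)
  also have "\<dots> = (\<Sum>x\<in>UNIV. \<Sum>y\<in>UNIV. b x y * (g $ x * h $ y - g $ y * h $ x))"
    unfolding schroedinger_nth
    by (simp add: algebra_simps sum_distrib_left sum_distrib_right sum_subtractf)
  also have "\<dots> = 0"
    using sum_flip[of "\<lambda>x y. g $ x * h $ y"] by (simp add: right_diff_distrib sum_subtractf mult.commute)
  finally show "H g \<bullet> h = g \<bullet> H h" by simp
qed

text \<open>
  By the eigenvalue equation for \<open>f\<close>, the potential and the diagonal terms cancel in
  \<open>H g - \<kappa> g = H g - c H f\<close>. Adding the resulting double sum to itself with \<open>x\<close> and \<open>y\<close>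
  exchanged completes the square.
\<close>

lemma form_of_multiple_of_eigenfunction:
  assumes f: "H f = \<kappa> *\<^sub>R f" and g: "\<And>x. g $ x = c x * f $ x"
  shows "2 * (g \<bullet> H g - \<kappa> * (g \<bullet> g))
    = (\<Sum>x\<in>UNIV. \<Sum>y\<in>UNIV. b x y * (f $ x * f $ y * (c x - c y)\<^sup>2))"
proof -
  have "H g $ x - \<kappa> * g $ x = (\<Sum>y\<in>UNIV. b x y * (f $ y * (c x - c y)))" for x
  proof -
    have "\<kappa> * g $ x = c x * H f $ x" by (simp add: f g)
    then show ?thesis
      unfolding schroedinger_nth
      by (simp add: g algebra_simps sum_distrib_left sum_subtractf)
  qed
  then have "g \<bullet> H g - \<kappa> * (g \<bullet> g)
      = (\<Sum>x\<in>UNIV. g $ x * (\<Sum>y\<in>UNIV. b x y * (f $ y * (c x - c y))))"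
    by (simp add: inner_vec_def sum_distrib_left sum_subtractf[symmetric] algebra_simps)
  also have "\<dots> = (\<Sum>x\<in>UNIV. \<Sum>y\<in>UNIV. b x y * (f $ x * f $ y * (c x - c y) * c x))"
    by (simp add: g sum_distrib_left ac_simps)
  finally have *: "g \<bullet> H g - \<kappa> * (g \<bullet> g)
      = (\<Sum>x\<in>UNIV. \<Sum>y\<in>UNIV. b x y * (f $ x * f $ y * (c x - c y) * c x))" .
  also have "\<dots> = (\<Sum>x\<in>UNIV. \<Sum>y\<in>UNIV. b x y * (f $ y * f $ x * (c y - c x) * c y))"
    by (rule sum_flip)
  finally have "2 * (g \<bullet> H g - \<kappa> * (g \<bullet> g))
      = (\<Sum>x\<in>UNIV. \<Sum>y\<in>UNIV. b x y * (f $ x * f $ y * (c x - c y) * c x)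
          + b x y * (f $ y * f $ x * (c y - c x) * c y))"
    using * by (simp add: sum.distrib)
  then show ?thesis by (simp add: power2_eq_square algebra_simps)
qed

text \<open>
  In the double sum, edges with \<open>f(x) f(y) > 0\<close> contribute zero, since their ends lie in the same
  domain, and all others contribute at most zero. If the total is zero, each term is.
\<close>

lemma form_of_rescale:
  assumes F: "nodal_family E f F" and f: "H f = \<kappa> *\<^sub>R f"
    and g_def: "g = rescale f F c"
  shows "g \<bullet> H g \<le> \<kappa> * (g \<bullet> g)"
    and "\<lbrakk>g \<bullet> H g = \<kappa> * (g \<bullet> g); {x, y} \<in> E; f $ x * f $ y < 0; D \<in> F; x \<in> D; D' \<in> F; y \<in> D'\<rbrakk>
      \<Longrightarrow> c D = c D'"
proof -
  \<comment> \<open>The factor at a vertex; where \<open>f\<close> is zero its value is arbitrary.\<close>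
  define d where "d x = c (THE D. D \<in> F \<and> x \<in> D)" for x
  have d: "d x = c D" if "f $ x \<noteq> 0" "D \<in> F" "x \<in> D" for x D
  proof -
    have "\<exists>!D. D \<in> F \<and> x \<in> D" using F that by (simp add: nodal_family_def)
    then show ?thesis unfolding d_def using that by (simp add: the1_equality)
  qed
  have ex: "\<exists>D\<in>F. x \<in> D" if "f $ x \<noteq> 0" for x
    using F that by (auto simp: nodal_family_def)
  have g: "g $ x = d x * f $ x" for x
  proof (cases "f $ x = 0")
    case False
    then show ?thesis using ex d rescale_nth[OF F] g_def by metis
  qed (simp add: g_def rescale_nth_zero)
  note form = form_of_multiple_of_eigenfunction[OF f g]
  have le: "b x y * (f $ x * f $ y * (d x - d y)\<^sup>2) \<le> 0" for x y
  proof (cases "{x, y} \<in> E \<and> f $ x * f $ y > 0")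
    case True
    then have nz: "f $ x \<noteq> 0" "f $ y \<noteq> 0" by auto
    obtain D where D: "D \<in> F" "x \<in> D" using ex nz by blast
    then have "y \<in> D" using F True unfolding nodal_family_def by blast
    then have "d x = d y" using d nz D by metis
    then show ?thesis by simp
  next
    case False
    then show ?thesis
      by (metis weight_zero weight_pos not_less mult_zero_left order_refl less_imp_le
          mult_nonneg_nonpos mult_nonpos_nonneg zero_le_power2)
  qed
  have "2 * (g \<bullet> H g - \<kappa> * (g \<bullet> g)) \<le> 0"
    unfolding form by (intro sum_nonpos le)
  then show "g \<bullet> H g \<le> \<kappa> * (g \<bullet> g)" by simp
  show "c D = c D'"
    if "g \<bullet> H g = \<kappa> * (g \<bullet> g)" "{x, y} \<in> E" "f $ x * f $ y < 0" "D \<in> F" "x \<in> D" "D' \<in> F" "y \<in> D'"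
  proof -
    have "(\<Sum>x\<in>UNIV. \<Sum>y\<in>UNIV. b x y * (f $ x * f $ y * (d x - d y)\<^sup>2)) = 0"
      using form that(1) by simp
    then have "(\<Sum>y\<in>UNIV. b x y * (f $ x * f $ y * (d x - d y)\<^sup>2)) = 0"
      using sum_nonneg_eq_0_iff[of UNIV "\<lambda>x. - (\<Sum>y\<in>UNIV. b x y * (f $ x * f $ y * (d x - d y)\<^sup>2))"]
      by (simp add: sum_negf sum_nonpos le)
    then have "b x y * (f $ x * f $ y * (d x - d y)\<^sup>2) = 0"
      using sum_nonneg_eq_0_iff[of UNIV "\<lambda>y. - (b x y * (f $ x * f $ y * (d x - d y)\<^sup>2))"]
      by (simp add: sum_negf le)
    moreover have "b x y \<noteq> 0" using weight_pos[OF that(2)] by simp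
    ultimately have "d x = d y" using that(3) by auto
    moreover have "f $ x \<noteq> 0" "f $ y \<noteq> 0" using that(3) by auto
    ultimately show ?thesis using d that by metis
  qed
qed

section \<open>The two bounds\<close>

text \<open>
  Too many domains would give a nonzero rescaling of \<open>f\<close> that is an eigenfunction for \<open>\<kappa>\<close> and
  orthogonal to the eigenspace of \<open>\<kappa>\<close>.
\<close>

lemma card_strong_nodal_domains_le:
  assumes f: "H f = \<kappa> *\<^sub>R f"
  shows "card {D. strong_nodal_domain E f D}
    \<le> dim (\<Union>\<mu>\<in>{\<mu> \<in> eigenvalues H. \<mu> \<le> \<kappa>}. eigenspace H \<mu>)" (is "card ?F \<le> dim ?A")
proof (rule ccontr)
  assume "\<not> ?thesis"
  then have many: "dim ?A < card ?F" by simp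
  obtain c where nz: "rescale f ?F c \<noteq> 0"
    and orth: "\<And>a. a \<in> ?A \<Longrightarrow> a \<bullet> rescale f ?F c = 0"
    by (rule exists_rescale_orthogonal[OF nodal_family_strong subset_refl many]) (rule that; assumption?)
  define g where "g = rescale f ?F c"
  have orth': "a \<bullet> g = 0" if "\<mu> \<le> \<kappa>" "a \<in> eigenspace H \<mu>" for a \<mu>
    using orth[of a] that by (cases "a = 0") (auto simp: eigenvalues_def eigenspace_def g_def)
  have "H g = \<kappa> *\<^sub>R g"
    by (rule eigenvector_if_form_le[OF _ form_of_rescale(1)[OF nodal_family_strong f g_def]])
      (rule orth'[OF less_imp_le])
  then have "g \<bullet> g = 0"
    using orth'[of \<kappa> g] by (simp add: eigenspace_def)
  then show False using nz by (simp add: g_def)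
qed

text \<open>
  The surplus domain \<open>D\<^sub>0\<close> pays for one more linear condition, that the factor on it is zero;
  connectedness carries this to every other domain.
\<close>

lemma card_weak_nodal_domains_le:
  assumes conn: "induced_connected E UNIV" and "f \<noteq> 0" and f: "H f = \<kappa> *\<^sub>R f"
  shows "card {D. weak_nodal_domain E f D}
    \<le> Suc (dim (\<Union>\<mu>\<in>{\<mu> \<in> eigenvalues H. \<mu> < \<kappa>}. eigenspace H \<mu>))" (is "card ?F \<le> Suc (dim ?A)")
proof (rule ccontr)
  assume many: "\<not> ?thesis"
  note F = nodal_family_weak[OF conn \<open>f \<noteq> 0\<close>]
  obtain D\<^sub>0 where D\<^sub>0: "D\<^sub>0 \<in> ?F" using many by fastforce
  then have "dim ?A < card (?F - {D\<^sub>0})" using many by simp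
  then obtain c where c0: "\<And>D. D \<notin> ?F - {D\<^sub>0} \<Longrightarrow> c D = 0" and nz: "rescale f ?F c \<noteq> 0"
    and orth: "\<And>a. a \<in> ?A \<Longrightarrow> a \<bullet> rescale f ?F c = 0"
    using exists_rescale_orthogonal[OF F, of "?F - {D\<^sub>0}" ?A] by blast
  define g where "g = rescale f ?F c"
  have orth': "a \<bullet> g = 0" if "\<mu> < \<kappa>" "a \<in> eigenspace H \<mu>" for a \<mu>
    using orth[of a] that by (cases "a = 0") (auto simp: eigenvalues_def eigenspace_def g_def)
  have eig: "H g = \<kappa> *\<^sub>R g"
    by (rule eigenvector_if_form_le[OF _ form_of_rescale(1)[OF F f g_def]]) (rule orth')
  have g: "g $ x = c D * f $ x" if "weak_nodal_domain E f D" "x \<in> D" for x D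
    unfolding g_def using rescale_nth[OF F] that by simp
  have one_sign: "f $ x * f $ y \<ge> 0" if "weak_nodal_domain E f D" "x \<in> D" "y \<in> D" for D x y
    using that by (simp add: weak_nodal_domain_def maximal_set_def)
  \<comment> \<open>Vanishing of \<open>c\<close> is propagated rather than vanishing of \<open>g\<close>: the latter holds at every zero
      of \<open>f\<close> and so says nothing there.\<close>
  define U where "U = \<Union>{D. weak_nodal_domain E f D \<and> c D = 0}"
  have "y \<in> U" if "x \<in> U" and e: "{x, y} \<in> E" for x y
  proof -
    obtain D where D: "weak_nodal_domain E f D" "c D = 0" "x \<in> D"
      using \<open>x \<in> U\<close> by (auto simp: U_def)
    show ?thesis
    proof (cases "y \<in> D")
      case True
      then show ?thesis using D by (auto simp: U_def)
    next
      case False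
      then obtain z where z: "z \<in> D" "f $ z * f $ y < 0"
        using weak_nodal_domain_neighbour[OF D(1,3) e] by force
      have "f $ x * f $ y \<le> 0"
        using one_sign[OF D(1) D(3) z(1)] z(2) by (auto simp: mult_less_0_iff mult_le_0_iff zero_le_mult_iff)
      have "f $ y \<noteq> 0" using z by auto
      show ?thesis
      proof (cases "f $ x = 0")
        case False
        then have neg: "f $ x * f $ y < 0"
          using \<open>f $ x * f $ y \<le> 0\<close> \<open>f $ y \<noteq> 0\<close> by (simp add: less_le)
        obtain D' where D': "weak_nodal_domain E f D'" "y \<in> D'"
          using F \<open>f $ y \<noteq> 0\<close> unfolding nodal_family_def by blast
        have "c D = c D'"
          using form_of_rescale(2)[OF F f g_def _ e neg] D D' eig by (simp add: g_def)
        then show ?thesis using D D' by (auto simp: U_def)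
      next
        case True
        have "one_signed E (\<lambda>t. t \<ge> 0) f {x, y}"
          using True induced_connected_edge[OF e] by (auto simp: one_signed_def)
        then obtain D' where D': "weak_nodal_domain E f D'" "x \<in> D'" "y \<in> D'"
          using maximal_set_superset[of "one_signed E (\<lambda>t. t \<ge> 0) f" "{x, y}"]
          by (metis weak_nodal_domain_eq insert_subset)
        \<comment> \<open>Here \<open>x\<close> is a zero of \<open>f\<close> in both \<open>D\<close> and \<open>D'\<close>. Its neighbours with the sign of \<open>f $ y\<close> lie
            in \<open>D'\<close>, those with the opposite sign in \<open>D\<close>, where \<open>g\<close> vanishes. So in the eigenvalue
            equation for \<open>g\<close> at \<open>x\<close> only a multiple of \<open>c D'\<close> by a positive sum remains.\<close>
        have nbr: "g $ u * f $ y = c D' * max 0 (f $ u * f $ y)" if u: "{x, u} \<in> E" for u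
        proof -
          consider "f $ u = 0" | "f $ u * f $ y > 0" | "f $ u * f $ y < 0"
            using \<open>f $ y \<noteq> 0\<close> by (metis linorder_neqE_linordered_idom mult_eq_0_iff)
          then show ?thesis
          proof cases
            case 1
            then show ?thesis by (simp add: g_def rescale_nth_zero)
          next
            case 2
            have "u \<in> D'"
            proof (rule weak_nodal_domain_neighbour[OF D'(1,2) u])
              show "f $ w * f $ u \<ge> 0" if "w \<in> D'" for w
                using sign_trans[of "\<lambda>t. t \<ge> 0" "f $ w" "f $ y" "f $ u"] 2 \<open>f $ y \<noteq> 0\<close>
                  one_sign[OF D'(1) that D'(3)] by simp
            qed
            then show ?thesis using g[OF D'(1)] 2 by simp
          next
            case 3
            have uz: "f $ u * f $ z \<ge> 0" "f $ z \<noteq> 0"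
              using 3 z(2) by (auto simp: mult_less_0_iff zero_le_mult_iff)
            have "u \<in> D"
            proof (rule weak_nodal_domain_neighbour[OF D(1,3) u])
              show "f $ w * f $ u \<ge> 0" if "w \<in> D" for w
                using sign_trans[of "\<lambda>t. t \<ge> 0" "f $ w" "f $ z" "f $ u"] uz
                  one_sign[OF D(1) that z(1)] by simp
            qed
            then show ?thesis using g[OF D(1)] D(2) 3 by simp
          qed
        qed
        have gx: "g $ x = 0" using True by (simp add: g_def rescale_nth_zero)
        then have "(\<Sum>u\<in>UNIV. b x u * g $ u) = 0"
          using arg_cong[OF eig, of "\<lambda>h. h $ x"] schroedinger_nth[of g x] by (simp add: sum_negf)
        then have "0 = (\<Sum>u\<in>UNIV. b x u * g $ u) * f $ y" by simp
        also have "\<dots> = (\<Sum>u\<in>UNIV. b x u * (g $ u * f $ y))"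
          by (simp add: sum_distrib_right mult.assoc)
        also have "\<dots> = (\<Sum>u\<in>UNIV. b x u * (c D' * max 0 (f $ u * f $ y)))"
          by (intro sum.cong refl) (metis nbr weight_zero mult_zero_left)
        also have "\<dots> = c D' * (\<Sum>u\<in>UNIV. b x u * max 0 (f $ u * f $ y))"
          by (simp add: sum_distrib_left mult.left_commute)
        finally have "c D' * (\<Sum>u\<in>UNIV. b x u * max 0 (f $ u * f $ y)) = 0" by simp
        moreover have "(\<Sum>u\<in>UNIV. b x u * max 0 (f $ u * f $ y)) > 0"
        proof (rule sum_pos2[of _ y])
          show "0 < b x y * max 0 (f $ y * f $ y)"
            using weight_pos[OF e] \<open>f $ y \<noteq> 0\<close> by (auto simp: less_max_iff_disj zero_less_mult_iff)
          show "0 \<le> b x u * max 0 (f $ u * f $ y)" for u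
            by (metis weight_pos weight_zero less_imp_le max.cobounded1 mult_nonneg_nonneg order_refl)
        qed auto
        ultimately have "c D' = 0" by simp
        then show ?thesis using D' by (auto simp: U_def)
      qed
    qed
  qed
  moreover have "D\<^sub>0 \<subseteq> U" "D\<^sub>0 \<noteq> {}"
    using D\<^sub>0 c0[of D\<^sub>0] F by (auto simp: U_def nodal_family_def)
  ultimately have "U = UNIV"
    using induced_connected_closed_eq_UNIV[OF conn, of _ U] by blast
  have "g $ x = 0" for x
  proof -
    have "x \<in> U" using \<open>U = UNIV\<close> by simp
    then obtain D where "weak_nodal_domain E f D" "c D = 0" "x \<in> D"
      by (auto simp: U_def)
    then show ?thesis using g by simp
  qed
  then show False using nz by (simp add: g_def vec_eq_iff)
qed

end

theorem theorem2:
  fixes E :: "'v::finite set set"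
    and b :: "'v \<Rightarrow> 'v \<Rightarrow> real"
    and v :: "'v \<Rightarrow> real"
    and k :: nat
    and f :: "real ^ 'v"
  assumes "simple_graph E"
    and "induced_connected E UNIV"
    and "\<And>x y. {x, y} \<in> E \<Longrightarrow> b x y = b y x \<and> b x y > 0"
    and "\<And>x y. {x, y} \<notin> E \<Longrightarrow> b x y = 0"
    and "1 \<le> k" and "k \<le> CARD('v)"
    and "f \<noteq> 0"
    and "schroedinger E b v f = nth_eigenvalue (schroedinger E b v) k *\<^sub>R f"
  shows "card {D. weak_nodal_domain E f D} \<le>
           Min {h \<in> {1..CARD('v)}.
             nth_eigenvalue (schroedinger E b v) h = nth_eigenvalue (schroedinger E b v) k}
       \<and> card {D. strong_nodal_domain E f D} \<le>
           Max {h \<in> {1..CARD('v)}.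
             nth_eigenvalue (schroedinger E b v) h = nth_eigenvalue (schroedinger E b v) k}"
proof -
  interpret weighted_graph E b v
  proof
    show "b x y = b y x" for x y
      using assms(3,4) by (metis insert_commute)
  qed (use assms(3,4) in auto)
  let ?\<kappa> = "nth_eigenvalue H k"
  let ?K = "{h \<in> {1..CARD('v)}. nth_eigenvalue H h = ?\<kappa>}"
  have k: "k \<in> ?K" and fin: "finite ?K" using assms(5,6) by auto
  have "Min ?K \<in> ?K" by (rule Min_in) (use k fin in auto)
  then have "Suc (dim (\<Union>\<mu>\<in>{\<mu> \<in> eigenvalues H. \<mu> < ?\<kappa>}. eigenspace H \<mu>)) \<le> Min ?K"
    using first_eigenvalue_index_gt by (simp add: Suc_le_eq)
  moreover have "dim (\<Union>\<mu>\<in>{\<mu> \<in> eigenvalues H. \<mu> \<le> ?\<kappa>}. eigenspace H \<mu>) \<le> Max ?K"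
    by (rule last_eigenvalue_index_ge[of k]) (use k fin in auto)
  ultimately show ?thesis
    using card_weak_nodal_domains_le[OF assms(2,7,8)] card_strong_nodal_domains_le[OF assms(8)]
    by (meson order_trans)
qed

end
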